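(* Let $(M,g)$ be a $k$-dimensional Riemannian manifold of constant scalar curvature, where $k=3$, or $k$ is such that a Hadamard matrix $H_k$ exists. Then for any $p\in M$ there exists a decomposition of $T_pM$ into the sum of one-dimensional pairwise orthogonal subspaces $\mathcal D_1,\ldots,\mathcal D_k$ such that $${\rm Ric}|_{\mathcal D_\mu\times\mathcal D_\mu}=\lambda\,g|_{\mathcal D_\mu\times\mathcal D_\mu},\qquad\mu=1,\ldots,k,$$ where $k\lambda$ is the scalar curvature of $(M,g)$.
   Context: ${\rm Ric}$ is the Ricci tensor of $(M,g)$. A Hadamard matrix $H_k$ is a $k\times k$ matrix with all entries in $\{-1,1\}$ such that $\frac1{\sqrt k}H_k$ is an orthogonal matrix. *)

theory Defs
  imports "HOL-Analysis.Analysis" "HOL-Library.Function_Algebras"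
begin

section \<open>Pointwise real vector space structure on functions\<close>

instantiation "fun" :: (type, real_vector) real_vector
begin

definition scaleR_fun :: "real \<Rightarrow> ('a \<Rightarrow> 'b) \<Rightarrow> 'a \<Rightarrow> 'b"
  where "scaleR_fun r f = (\<lambda>x. r *\<^sub>R f x)"

instance
  by standard (auto simp: scaleR_fun_def fun_eq_iff scaleR_add_right scaleR_add_left)

end


section \<open>Smooth maps between open subsets of Euclidean spaces\<close>

text \<open>The recursion is meant for open \<open>S\<close>. On a finite-dimensional domain, a map is
  of class $C^{n+1}$ iff it is differentiable and all its directional derivatives are of class $C^n$.\<close>

primrec Ck_on :: "nat \<Rightarrow> 'a::euclidean_space set \<Rightarrow> ('a \<Rightarrow> 'b::real_normed_vector) \<Rightarrow> bool" where
  "Ck_on 0 S = (\<lambda>f. continuous_on S f)"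
| "Ck_on (Suc n) S = (\<lambda>f. (\<forall>x\<in>S. f differentiable (at x)) \<and>
      (\<forall>v. Ck_on n S (\<lambda>x. frechet_derivative f (at x) v)))"

definition smooth_on :: "'a::euclidean_space set \<Rightarrow> ('a \<Rightarrow> 'b::real_normed_vector) \<Rightarrow> bool"
  where "smooth_on S f \<longleftrightarrow> (\<forall>n. Ck_on n S f)"

definition partial :: "'n::finite \<Rightarrow> (real^'n \<Rightarrow> real) \<Rightarrow> real^'n \<Rightarrow> real"
  where "partial i f x = frechet_derivative f (at x) (axis i 1)"


section \<open>Smooth and Riemannian manifolds\<close>

text \<open>A chart is a pair \<open>(U, \<phi>)\<close>; the values of \<open>\<phi>\<close> outside \<open>U\<close> are irrelevant.\<close>

type_synonym ('a, 'n) chart = "'a set \<times> ('a \<Rightarrow> real^'n)"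

abbreviation chart_image :: "('a, 'n::finite) chart \<Rightarrow> (real^'n) set"
  where "chart_image c \<equiv> snd c ` fst c"

definition chart_inv :: "('a, 'n::finite) chart \<Rightarrow> real^'n \<Rightarrow> 'a"
  where "chart_inv c = inv_into (fst c) (snd c)"

definition transition :: "('a, 'n::finite) chart \<Rightarrow> ('a, 'n) chart \<Rightarrow> real^'n \<Rightarrow> real^'n"
  where "transition c d = snd d \<circ> chart_inv c"

definition chart_on :: "'a topology \<Rightarrow> ('a, 'n::finite) chart \<Rightarrow> bool"
  where "chart_on X c \<longleftrightarrow>
    openin X (fst c) \<and> open (chart_image c) \<and>
    homeomorphic_map (subtopology X (fst c)) (top_of_set (chart_image c)) (snd c)"

definition smooth_atlas :: "'a topology \<Rightarrow> ('a, 'n::finite) chart set \<Rightarrow> bool"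
  where "smooth_atlas X A \<longleftrightarrow>
    (\<forall>c\<in>A. chart_on X c) \<and> \<Union> (fst ` A) = topspace X \<and>
    (\<forall>c\<in>A. \<forall>d\<in>A. smooth_on (snd c ` (fst c \<inter> fst d)) (transition c d))"

text \<open>A tangent vector at a point assigns to every chart around that point a coordinate vector,
  so that any two of these are related by the Jacobian of the transition map. On all other
  charts it is normalised to 0.\<close>

type_synonym ('a, 'n) tangent_vector = "('a, 'n) chart \<Rightarrow> real^'n"

record ('a, 'n) riemannian_structure =
  mtopology :: "'a topology"
  atlas :: "('a, 'n::finite) chart set"
  metric :: "'a \<Rightarrow> ('a, 'n) tangent_vector \<Rightarrow> ('a, 'n) tangent_vector \<Rightarrow> real"

abbreviation points :: "('a, 'n::finite) riemannian_structure \<Rightarrow> 'a set"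
  where "points M \<equiv> topspace (mtopology M)"

definition charts_at :: "('a, 'n::finite) riemannian_structure \<Rightarrow> 'a \<Rightarrow> ('a, 'n) chart set"
  where "charts_at M p = {c \<in> atlas M. p \<in> fst c}"

definition tangent_space ::
    "('a, 'n::finite) riemannian_structure \<Rightarrow> 'a \<Rightarrow> ('a, 'n) tangent_vector set"
  where "tangent_space M p =
    {v. (\<forall>c\<in>charts_at M p. \<forall>d\<in>charts_at M p.
            v d = frechet_derivative (transition c d) (at (snd c p)) (v c)) \<and>
        (\<forall>c. c \<notin> charts_at M p \<longrightarrow> v c = 0)}"

text \<open>The coordinate vector field $\partial/\partial x^i$ of the chart \<open>c\<close> at \<open>p\<close>.\<close>

definition coord_vector ::
    "('a, 'n::finite) riemannian_structure \<Rightarrow> ('a, 'n) chart \<Rightarrow> 'a \<Rightarrow> 'n \<Rightarrow> ('a, 'n) tangent_vector"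
  where "coord_vector M c p i =
    (\<lambda>d. if d \<in> charts_at M p
         then frechet_derivative (transition c d) (at (snd c p)) (axis i 1) else 0)"

definition metric_matrix ::
    "('a, 'n::finite) riemannian_structure \<Rightarrow> ('a, 'n) chart \<Rightarrow> real^'n \<Rightarrow> real^'n^'n"
  where "metric_matrix M c x =
    (\<chi> i j. metric M (chart_inv c x)
              (coord_vector M c (chart_inv c x) i) (coord_vector M c (chart_inv c x) j))"

definition inner_product_on :: "'v::real_vector set \<Rightarrow> ('v \<Rightarrow> 'v \<Rightarrow> real) \<Rightarrow> bool"
  where "inner_product_on V b \<longleftrightarrow>
    (\<forall>u\<in>V. \<forall>v\<in>V. \<forall>w\<in>V. b (u + v) w = b u w + b v w) \<and>
    (\<forall>u\<in>V. \<forall>w\<in>V. \<forall>r. b (r *\<^sub>R u) w = r * b u w) \<and>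
    (\<forall>u\<in>V. \<forall>w\<in>V. b u w = b w u) \<and>
    (\<forall>u\<in>V. u \<noteq> 0 \<longrightarrow> b u u > 0)"

definition riemannian_manifold :: "('a, 'n::finite) riemannian_structure \<Rightarrow> bool"
  where "riemannian_manifold M \<longleftrightarrow>
    Hausdorff_space (mtopology M) \<and> second_countable (mtopology M) \<and>
    smooth_atlas (mtopology M) (atlas M) \<and>
    (\<forall>p\<in>points M. inner_product_on (tangent_space M p) (metric M p)) \<and>
    (\<forall>c\<in>atlas M. \<forall>i j. smooth_on (chart_image c) (\<lambda>x. metric_matrix M c x $ i $ j))"


section \<open>Levi-Civita connection and curvature\<close>

text \<open>\<open>christoffel M c k i j\<close> is $\Gamma^k_{ij}$, where
  $\nabla_{\partial_i} \partial_j = \Gamma^k_{ij} \partial_k$ for the Levi-Civita connection.\<close>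

definition christoffel ::
    "('a, 'n::finite) riemannian_structure \<Rightarrow> ('a, 'n) chart \<Rightarrow> 'n \<Rightarrow> 'n \<Rightarrow> 'n \<Rightarrow> real^'n \<Rightarrow> real"
  where "christoffel M c k i j x =
    1 / 2 * (\<Sum>l\<in>UNIV. matrix_inv (metric_matrix M c x) $ k $ l *
      (partial i (\<lambda>y. metric_matrix M c y $ j $ l) x
       + partial j (\<lambda>y. metric_matrix M c y $ i $ l) x
       - partial l (\<lambda>y. metric_matrix M c y $ i $ j) x))"

text \<open>\<open>riemann M c l k i j\<close> is the coefficient of $\partial_l$ in $R(\partial_i, \partial_j) \partial_k$,
  where $R(X,Y) = [\nabla_X, \nabla_Y] - \nabla_{[X,Y]}$.\<close>

definition riemann ::
    "('a, 'n::finite) riemannian_structure \<Rightarrow> ('a, 'n) chart \<Rightarrow> 'n \<Rightarrow> 'n \<Rightarrow> 'n \<Rightarrow> 'n \<Rightarrow> real^'n \<Rightarrow> real"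
  where "riemann M c l k i j x =
    partial i (christoffel M c l j k) x - partial j (christoffel M c l i k) x
    + (\<Sum>m\<in>UNIV. christoffel M c l i m x * christoffel M c m j k x
                - christoffel M c l j m x * christoffel M c m i k x)"

text \<open>${\rm Ric}(Y,Z)$ is the trace of $X \mapsto R(X,Y)Z$.\<close>

definition ricci_matrix ::
    "('a, 'n::finite) riemannian_structure \<Rightarrow> ('a, 'n) chart \<Rightarrow> real^'n \<Rightarrow> real^'n^'n"
  where "ricci_matrix M c x = (\<chi> j k. \<Sum>i\<in>UNIV. riemann M c i k i j x)"

text \<open>By tensoriality of the curvature, the chart at \<open>p\<close> used to evaluate the Ricci tensor and
  the scalar curvature is immaterial.\<close>

definition chart_at :: "('a, 'n::finite) riemannian_structure \<Rightarrow> 'a \<Rightarrow> ('a, 'n) chart"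
  where "chart_at M p = (SOME c. c \<in> charts_at M p)"

definition ricci ::
    "('a, 'n::finite) riemannian_structure \<Rightarrow> 'a \<Rightarrow>
      ('a, 'n) tangent_vector \<Rightarrow> ('a, 'n) tangent_vector \<Rightarrow> real"
  where "ricci M p u v =
    (let c = chart_at M p in
      \<Sum>i\<in>UNIV. \<Sum>j\<in>UNIV. ricci_matrix M c (snd c p) $ i $ j * u c $ i * v c $ j)"

definition scalar_curvature :: "('a, 'n::finite) riemannian_structure \<Rightarrow> 'a \<Rightarrow> real"
  where "scalar_curvature M p =
    (let c = chart_at M p in
      \<Sum>i\<in>UNIV. \<Sum>j\<in>UNIV. matrix_inv (metric_matrix M c (snd c p)) $ i $ j
                          * ricci_matrix M c (snd c p) $ i $ j)"


section \<open>Hadamard matrices and direct sums\<close>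

definition hadamard_matrix :: "real^'n::finite^'n \<Rightarrow> bool"
  where "hadamard_matrix H \<longleftrightarrow>
    (\<forall>i j. H $ i $ j \<in> {-1, 1}) \<and> orthogonal_matrix ((1 / sqrt (real CARD('n))) *\<^sub>R H)"

definition direct_sum_decomposition :: "'v::real_vector set \<Rightarrow> 'i set \<Rightarrow> ('i \<Rightarrow> 'v set) \<Rightarrow> bool"
  where "direct_sum_decomposition V I D \<longleftrightarrow>
    (\<forall>i\<in>I. subspace (D i) \<and> D i \<subseteq> V) \<and>
    (\<forall>v\<in>V. \<exists>!w. w \<in> (\<Pi>\<^sub>E i\<in>I. D i) \<and> v = (\<Sum>i\<in>I. w i))"

end

theory Submission
  imports Defs
begin

text \<open>In a \<open>g\<close>-orthonormal basis of the tangent space the diagonal entries of the Ricci form have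
  mean \<open>\<lambda>\<close>. If they are not all equal to \<open>\<lambda>\<close>, one of them is smaller and another one larger
  than \<open>\<lambda>\<close>. Rotating these two basis vectors in their plane keeps the sum of the two entries, and by
  the intermediate value theorem some rotation turns one of them into \<open>\<lambda>\<close>. Each such step lowers
  the number of entries different from \<open>\<lambda>\<close>, so the process ends with a constant diagonal.\<close>

section \<open>Equalising the diagonal of a bilinear form\<close>

text \<open>The index set is a parameter so that a family can be built up by induction on
  it.\<close>

definition orthonormal_family :: "('v \<Rightarrow> 'v \<Rightarrow> real) \<Rightarrow> 'i set \<Rightarrow> ('i \<Rightarrow> 'v) \<Rightarrow> bool"
  where "orthonormal_family b I e \<longleftrightarrow> (\<forall>i\<in>I. \<forall>j\<in>I. b (e i) (e j) = (if i = j then 1 else 0))"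

lemma inner_product_on_UNIV_imp_bilinear:
  assumes "inner_product_on UNIV b"
  shows "bilinear b"
proof -
  have sym: "b u w = b w u" for u w
    using assms unfolding inner_product_on_def by blast
  have "linear (\<lambda>u. b u w)" for w
    using assms unfolding inner_product_on_def by (intro linearI) auto
  moreover from this have "linear (b w)" for w
    by (subst (asm) sym)
  ultimately show ?thesis
    by (simp add: bilinear_def)
qed

lemmas bilinear_expand =
  bilinear_ladd bilinear_radd bilinear_lmul bilinear_rmul bilinear_lsub bilinear_rsub

text \<open>The value of the form runs continuously from \<open>B x x\<close> at
  \<open>t = 0\<close> to \<open>B y y\<close> at \<open>t = pi / 2\<close>, so the intermediate
  value theorem applies on this quarter circle.\<close>

lemma bilinear_level_in_plane:
  assumes B: "bilinear (B :: 'v::real_vector \<Rightarrow> 'v \<Rightarrow> real)" and le: "B x x \<le> lam" "lam \<le> B y y"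
  obtains t :: real where
    "B (cos t *\<^sub>R x + sin t *\<^sub>R y) (cos t *\<^sub>R x + sin t *\<^sub>R y) = lam"
proof -
  \<comment> \<open>Expanding first makes continuity visible. The form \<open>B\<close> is a general
    bilinear one, so \<open>B x y\<close> and \<open>B y x\<close> stay separate.\<close>
  define f where "f t = (cos t)\<^sup>2 * B x x + (sin t)\<^sup>2 * B y y + cos t * sin t * (B x y + B y x)" for t
  have f_eq: "f t = B (cos t *\<^sub>R x + sin t *\<^sub>R y) (cos t *\<^sub>R x + sin t *\<^sub>R y)" for t
    by (simp add: f_def bilinear_expand[OF B] algebra_simps power2_eq_square)
  have "\<exists>t. 0 \<le> t \<and> t \<le> pi / 2 \<and> f t = lam"
    unfolding f_def using le by (intro IVT') (auto intro!: continuous_intros)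
  then show thesis
    using f_eq that by metis
qed

text \<open>The mixed terms of the two summands cancel, and the squares combine to
  \<open>cos\<^sup>2 + sin\<^sup>2 = 1\<close>.\<close>

lemma bilinear_rotation_trace:
  assumes B: "bilinear (B :: 'v::real_vector \<Rightarrow> 'v \<Rightarrow> real)"
  shows "B (cos t *\<^sub>R x + sin t *\<^sub>R y) (cos t *\<^sub>R x + sin t *\<^sub>R y)
       + B (cos t *\<^sub>R y - sin t *\<^sub>R x) (cos t *\<^sub>R y - sin t *\<^sub>R x) = B x x + B y y"
proof -
  have "B (c *\<^sub>R x + s *\<^sub>R y) (c *\<^sub>R x + s *\<^sub>R y)
      + B (c *\<^sub>R y - s *\<^sub>R x) (c *\<^sub>R y - s *\<^sub>R x) = (c\<^sup>2 + s\<^sup>2) * (B x x + B y y)" for c s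
    by (simp add: bilinear_expand[OF B] algebra_simps power2_eq_square)
  then show ?thesis
    by simp
qed

text \<open>The new pair is orthonormal by the Pythagorean identity and stays in the plane of
  \<open>e i\<close> and \<open>e j\<close>, to which all other members are orthogonal.\<close>

lemma orthonormal_family_rotate:
  assumes b: "bilinear b" and sym: "\<And>x y. b x y = b y x"
    and e: "orthonormal_family b I e" and ij: "i \<in> I" "j \<in> I" "i \<noteq> j"
  shows "orthonormal_family b I
    (e(i := cos t *\<^sub>R e i + sin t *\<^sub>R e j, j := cos t *\<^sub>R e j - sin t *\<^sub>R e i))"
    (is "orthonormal_family b I ?e")
proof -
  have o: "b (e k) (e l) = (if k = l then 1 else 0)" if "k \<in> I" "l \<in> I" for k l
    using e that by (simp add: orthonormal_family_def)
  have ii: "b (?e i) (?e i) = 1" and jj: "b (?e j) (?e j) = 1" and ij0: "b (?e i) (?e j) = 0"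
    using ij by (simp_all add: bilinear_expand[OF b] o flip: power2_eq_square)
  have ik: "b (?e i) (?e k) = 0" and jk: "b (?e j) (?e k) = 0"
    if "k \<in> I" "k \<noteq> i" "k \<noteq> j" for k
    using ij that by (auto simp: bilinear_expand[OF b] o)
  have "b (?e k) (?e l) = (if k = l then 1 else 0)" if "k \<in> I" "l \<in> I" for k l
  proof -
    consider "k = i" | "k = j" | "k \<noteq> i" "k \<noteq> j" by blast
    then show ?thesis
    proof cases
      case 1
      then show ?thesis
        \<comment> \<open>The collected facts speak about \<open>?e\<close> as a whole, so the
          update must not be unfolded here.\<close>
        using ii ij0 ik[of l] that ij by (cases "l = i"; cases "l = j") (auto simp del: fun_upd_apply)
    next
      case 2
      then show ?thesis
        using jj ij0 jk[of l] sym[of "?e j" "?e i"] that ij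
        by (cases "l = i"; cases "l = j") (auto simp del: fun_upd_apply)
    next
      case 3
      then show ?thesis
        using ik[of k] jk[of k] sym[of "?e k" "?e i"] sym[of "?e k" "?e j"] that ij o[of k l]
        by (cases "l = i"; cases "l = j") (auto simp del: fun_upd_apply simp: fun_upd_other)
    qed
  qed
  then show ?thesis
    by (simp add: orthonormal_family_def)
qed

text \<open>Induction on the number of indices whose diagonal entry differs from
  \<open>lam\<close>.\<close>

lemma orthonormal_family_constant_diagonal:
  assumes b: "bilinear b" and sym: "\<And>x y. b x y = b y x" and B: "bilinear B"
    and I: "finite I" and e: "orthonormal_family b I e"
    and sum_eq: "(\<Sum>i\<in>I. B (e i) (e i)) = real (card I) * lam"
  shows "\<exists>e'. orthonormal_family b I e' \<and> (\<forall>i\<in>I. B (e' i) (e' i) = lam)"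
  using e sum_eq
proof (induction "card {i\<in>I. B (e i) (e i) \<noteq> lam}" arbitrary: e rule: less_induct)
  case less
  let ?q = "\<lambda>i. B (e i) (e i)"
  show ?case
  proof (cases "\<forall>i\<in>I. ?q i = lam")
    case True
    then show ?thesis using less.prems(1) by blast
  next
    case False
    have sum0: "(\<Sum>i\<in>I. ?q i - lam) = 0" "(\<Sum>i\<in>I. lam - ?q i) = 0"
      using less.prems(2) by (simp_all add: sum_subtractf)
    \<comment> \<open>The deviations from \<open>lam\<close> sum to zero. If none were negative they
      would all vanish, contrary to the case assumption; the same argument with signs reversed gives
      \<open>j\<close>.\<close>
    have "\<exists>i\<in>I. ?q i < lam"
      using sum_nonneg_eq_0_iff[OF I, of "\<lambda>i. ?q i - lam"] sum0(1) False
      by - (rule ccontr, auto simp: not_less)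
    then obtain i where i: "i \<in> I" "?q i < lam" by blast
    have "\<exists>j\<in>I. lam < ?q j"
      using sum_nonneg_eq_0_iff[OF I, of "\<lambda>i. lam - ?q i"] sum0(2) False
      by - (rule ccontr, auto simp: not_less)
    then obtain j where j: "j \<in> I" "lam < ?q j" by blast
    from i j have ij: "i \<noteq> j" by auto
    obtain t where t: "B (cos t *\<^sub>R e i + sin t *\<^sub>R e j) (cos t *\<^sub>R e i + sin t *\<^sub>R e j) = lam"
      using bilinear_level_in_plane[OF B, of "e i" lam "e j"] i j by force
    define e1 where
      "e1 = e(i := cos t *\<^sub>R e i + sin t *\<^sub>R e j, j := cos t *\<^sub>R e j - sin t *\<^sub>R e i)"
    let ?q1 = "\<lambda>i. B (e1 i) (e1 i)"
    have e1: "orthonormal_family b I e1"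
      unfolding e1_def using less.prems(1) b sym i(1) j(1) ij by (intro orthonormal_family_rotate)
    have q1i: "?q1 i = lam"
      using ij t by (simp add: e1_def)
    have q1ij: "?q1 i + ?q1 j = ?q i + ?q j"
      using ij bilinear_rotation_trace[OF B] by (simp add: e1_def)
    have q1k: "?q1 k = ?q k" if "k \<noteq> i" "k \<noteq> j" for k
      using that by (simp add: e1_def)
    have split: "sum h I = h i + h j + sum h (I - {i, j})" for h :: "_ \<Rightarrow> real"
      using I i(1) j(1) ij sum.subset_diff[of "{i, j}" I h] by simp
    have "sum ?q1 I = sum ?q I"
      using q1ij q1k by (simp add: split)
    then have sum1: "sum ?q1 I = real (card I) * lam"
      using less.prems(2) by simp
    \<comment> \<open>The index \<open>i\<close> leaves the set of bad indices. The index
      \<open>j\<close> was bad before, so its new entry cannot enlarge the set.\<close>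
    have "{k\<in>I. ?q1 k \<noteq> lam} \<subset> {k\<in>I. ?q k \<noteq> lam}"
    proof
      show "{k\<in>I. ?q1 k \<noteq> lam} \<subseteq> {k\<in>I. ?q k \<noteq> lam}"
      proof
        fix k assume "k \<in> {k\<in>I. ?q1 k \<noteq> lam}"
        then show "k \<in> {k\<in>I. ?q k \<noteq> lam}"
          using q1i q1k[of k] j by (cases "k = i"; cases "k = j") auto
      qed
      show "{k\<in>I. ?q1 k \<noteq> lam} \<noteq> {k\<in>I. ?q k \<noteq> lam}"
        using q1i i by force
    qed
    then have "card {k\<in>I. ?q1 k \<noteq> lam} < card {k\<in>I. ?q k \<noteq> lam}"
      using I by (intro psubset_card_mono) auto
    then show ?thesis
      using less.hyps[OF _ e1 sum1] by simp
  qed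
qed


section \<open>Orthonormal bases for a Gram matrix\<close>

text \<open>Gram-Schmidt: as long as fewer vectors than the dimension are present, some
  \<open>w\<close> lies outside their span. Subtracting its projection and normalising yields the
  next member.\<close>

lemma ex_orthonormal_family:
  fixes b :: "'v::euclidean_space \<Rightarrow> 'v \<Rightarrow> real"
  assumes ip: "inner_product_on UNIV b"
  shows "finite I \<Longrightarrow> card I \<le> DIM('v) \<Longrightarrow> \<exists>e. orthonormal_family b I e"
proof (induction I rule: finite_induct)
  case empty
  then show ?case by (simp add: orthonormal_family_def)
next
  case (insert k F)
  note b = inner_product_on_UNIV_imp_bilinear[OF ip]
  have sym: "b x y = b y x" and pos: "x \<noteq> 0 \<Longrightarrow> b x x > 0" for x y
    using ip unfolding inner_product_on_def by blast+
  obtain e where e: "orthonormal_family b F e"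
    using insert by auto
  have "dim (span (e ` F)) < DIM('v)"
    using dim_le_card'[of "e ` F"] card_image_le[of F e] insert by simp
  then obtain w where w: "w \<notin> span (e ` F)"
    by (metis UNIV_eq_I dim_UNIV less_irrefl)
  define w' where "w' = w - (\<Sum>i\<in>F. b w (e i) *\<^sub>R e i)"
  have "(\<Sum>i\<in>F. b w (e i) *\<^sub>R e i) \<in> span (e ` F)"
    by (intro span_sum span_scale span_base) auto
  with w have "w' \<noteq> 0"
    by (auto simp: w'_def)
  then have w'_pos: "b w' w' > 0" by (rule pos)
  have lin: "linear (\<lambda>x. b x y)" for y
    using b by (simp add: bilinear_def)
  have orth: "b w' (e j) = 0" if "j \<in> F" for j
  proof -
    have "b (\<Sum>i\<in>F. b w (e i) *\<^sub>R e i) (e j) = (\<Sum>i\<in>F. b w (e i) * b (e i) (e j))"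
      by (simp add: linear_sum[OF lin] linear_cmul[OF lin])
    also have "\<dots> = (\<Sum>i\<in>F. if i = j then b w (e j) else 0)"
      using e that by (intro sum.cong) (auto simp: orthonormal_family_def)
    also have "\<dots> = b w (e j)"
      using that insert.hyps(1) by simp
    finally show ?thesis
      by (simp add: w'_def bilinear_lsub[OF b])
  qed
  define u where "u = (1 / sqrt (b w' w')) *\<^sub>R w'"
  have "b u u = 1"
    using w'_pos by (simp add: u_def bilinear_expand[OF b])
  moreover have "b u (e j) = 0" "b (e j) u = 0" if "j \<in> F" for j
    using orth[OF that] sym[of "e j" w'] by (simp_all add: u_def bilinear_expand[OF b])
  ultimately have "orthonormal_family b (insert k F) (e(k := u))"
    using e insert.hyps(2) unfolding orthonormal_family_def by auto
  then show ?case by blast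
qed

text \<open>With the family as columns of \<open>E\<close>, orthonormality says
  \<open>transpose E ** G ** E = mat 1\<close>. A one-sided inverse of a square matrix is two-sided,
  so \<open>E\<close> may be moved to the front.\<close>

lemma orthonormal_family_columns:
  fixes G :: "real^'n^'n" and e :: "'n \<Rightarrow> real^'n"
  assumes "orthonormal_family (\<lambda>x y. x \<bullet> (G *v y)) UNIV e"
  defines "E \<equiv> (\<chi> i a. e a $ i)"
  shows "(E ** transpose E) ** G = mat 1"
proof -
  have entry: "(transpose E ** (G ** E)) $ a $ c = e a \<bullet> (G *v e c)" for a c
    by (simp add: E_def matrix_matrix_mult_def matrix_vector_mult_def transpose_def inner_vec_def)
  have "transpose E ** (G ** E) = mat 1"
    using assms(1)
    by (simp add: vec_eq_iff entry mat_def orthonormal_family_def)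
  then have "(transpose E ** G) ** E = mat 1"
    by (simp only: matrix_mul_assoc)
  then have "E ** (transpose E ** G) = mat 1"
    by (rule matrix_left_right_inverse[THEN iffD1])
  then show ?thesis
    by (simp only: matrix_mul_assoc)
qed

text \<open>Apply the preceding matrix identity to \<open>x\<close>: the coefficients are the
  entries of \<open>transpose E *v (G *v x)\<close>.\<close>

lemma orthonormal_family_expansion:
  fixes G :: "real^'n^'n" and e :: "'n \<Rightarrow> real^'n"
  assumes "orthonormal_family (\<lambda>x y. x \<bullet> (G *v y)) UNIV e"
  shows "x = (\<Sum>a\<in>UNIV. (e a \<bullet> (G *v x)) *\<^sub>R e a)"
proof -
  define E where "E = (\<chi> i a. e a $ i)"
  define y where "y = transpose E *v (G *v x)"
  have "E *v y = ((E ** transpose E) ** G) *v x"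
    by (simp only: y_def matrix_vector_mul_assoc matrix_mul_assoc)
  then have "x = E *v y"
    using orthonormal_family_columns[OF assms] by (simp only: E_def matrix_vector_mul_lid)
  also have "\<dots> = (\<Sum>a\<in>UNIV. y $ a *\<^sub>R e a)"
    by (simp add: vec_eq_iff matrix_vector_mult_def E_def mult.commute)
  also have "\<dots> = (\<Sum>a\<in>UNIV. (e a \<bullet> (G *v x)) *\<^sub>R e a)"
  proof -
    have "(transpose E *v z) $ a = e a \<bullet> z" for z a
      by (simp add: E_def matrix_vector_mult_def transpose_def inner_vec_def)
    then show ?thesis
      by (simp only: y_def)
  qed
  finally show ?thesis .
qed

section \<open>The inverse Gram matrix and the trace of a form\<close>

lemma matrix_inv_eqI:
  fixes A B :: "real^'n^'n"
  assumes "A ** B = mat 1"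
  shows "matrix_inv B = A"
proof -
  have "B ** A = mat 1"
    using assms matrix_left_right_inverse by blast
  \<comment> \<open>\<open>matrix_inv\<close> is a choice, so its defining property is available
    only once \<open>A\<close> is exhibited as a two-sided inverse.\<close>
  then have inv: "B ** matrix_inv B = mat 1 \<and> matrix_inv B ** B = mat 1"
    unfolding matrix_inv_def using assms
    by (intro someI[of "\<lambda>C. B ** C = mat 1 \<and> C ** B = mat 1" A] conjI)
  have "matrix_inv B = (A ** B) ** matrix_inv B"
    by (simp only: assms matrix_mul_lid)
  also have "\<dots> = A ** (B ** matrix_inv B)"
    by (simp only: matrix_mul_assoc)
  finally show ?thesis
    by (simp only: inv matrix_mul_rid)
qed

text \<open>Both sides are the trace of \<open>R\<close> with respect to \<open>G\<close>, since
  \<open>matrix_inv G = E ** transpose E\<close>. With the Ricci matrix for \<open>R\<close>, the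
  right side is the scalar curvature.\<close>

lemma orthonormal_family_matrix_inv:
  fixes G R :: "real^'n^'n" and e :: "'n \<Rightarrow> real^'n"
  assumes "orthonormal_family (\<lambda>x y. x \<bullet> (G *v y)) UNIV e"
  shows "(\<Sum>a\<in>UNIV. e a \<bullet> (R *v e a)) = (\<Sum>i\<in>UNIV. \<Sum>j\<in>UNIV. matrix_inv G $ i $ j * R $ i $ j)"
proof -
  define E where "E = (\<chi> i a. e a $ i)"
  have "(E ** transpose E) ** G = mat 1"
    using orthonormal_family_columns[OF assms] by (simp add: E_def)
  then have "matrix_inv G = E ** transpose E"
    by (rule matrix_inv_eqI)
  then have inv: "matrix_inv G $ i $ j = (\<Sum>a\<in>UNIV. e a $ i * e a $ j)" for i j
    by (simp add: E_def matrix_matrix_mult_def transpose_def)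
  have "(\<Sum>a\<in>UNIV. e a \<bullet> (R *v e a)) = (\<Sum>a\<in>UNIV. \<Sum>i\<in>UNIV. \<Sum>j\<in>UNIV. e a $ i * e a $ j * R $ i $ j)"
    by (simp add: inner_vec_def matrix_vector_mult_def sum_distrib_left mult_ac)
  also have "\<dots> = (\<Sum>i\<in>UNIV. \<Sum>a\<in>UNIV. \<Sum>j\<in>UNIV. e a $ i * e a $ j * R $ i $ j)"
    by (rule sum.swap)
  also have "\<dots> = (\<Sum>i\<in>UNIV. \<Sum>j\<in>UNIV. \<Sum>a\<in>UNIV. e a $ i * e a $ j * R $ i $ j)"
    by (rule sum.cong[OF refl], rule sum.swap)
  finally show ?thesis
    by (simp add: inv sum_distrib_right)
qed


section \<open>Tangent vectors in a chart\<close>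

lemma chart_inv_chart:
  assumes "chart_on X c" "q \<in> fst c"
  shows "chart_inv c (snd c q) = q"
proof -
  have "fst c \<subseteq> topspace X"
    using assms(1) unfolding chart_on_def by (intro openin_subset) (rule conjunct1)
  moreover have "homeomorphic_map (subtopology X (fst c)) (top_of_set (chart_image c)) (snd c)"
    using assms(1) unfolding chart_on_def by (elim conjE)
  then have "inj_on (snd c) (topspace X \<inter> fst c)"
    by (auto dest: homeomorphic_imp_injective_map)
  ultimately have "inj_on (snd c) (fst c)"
    by (simp add: Int_absorb1)
  then show ?thesis
    using assms(2) by (simp add: chart_inv_def)
qed

text \<open>Provides an open neighbourhood on which transition maps can be compared before
  differentiating.\<close>

lemma open_chart_overlap:
  assumes "chart_on X c" "chart_on X d"
  shows "open (snd c ` (fst c \<inter> fst d))"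
proof -
  have "openin (subtopology X (fst c)) (fst c \<inter> fst d)"
    using assms by (simp add: chart_on_def openin_subtopology_Int2)
  moreover have "open_map (subtopology X (fst c)) (top_of_set (chart_image c)) (snd c)"
    using assms by (simp add: chart_on_def homeomorphic_imp_open_map)
  ultimately have "openin (top_of_set (chart_image c)) (snd c ` (fst c \<inter> fst d))"
    by (simp add: open_map_def)
  then show ?thesis
    using assms(1) by (simp add: chart_on_def openin_open_eq)
qed

lemma smooth_on_imp_differentiable:
  assumes "smooth_on S f" "x \<in> S"
  shows "f differentiable (at x)"
proof -
  have "Ck_on (Suc 0) S f"
    using assms(1) unfolding smooth_on_def by blast
  then show ?thesis
    using assms(2) by simp
qed

lemma transition_has_derivative:
  assumes "smooth_atlas X A" "c \<in> A" "d \<in> A" "p \<in> fst c" "p \<in> fst d"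
  shows "(transition c d has_derivative frechet_derivative (transition c d) (at (snd c p))) (at (snd c p))"
  using assms smooth_on_imp_differentiable[of "snd c ` (fst c \<inter> fst d)" "transition c d" "snd c p"]
  by (auto simp: smooth_atlas_def frechet_derivative_works)

text \<open>The chain rule for the cocycle identity of transition maps.\<close>

lemma transition_derivative_compose:
  assumes A: "smooth_atlas X A" and c: "c \<in> A" "p \<in> fst c" and d: "d \<in> A" "p \<in> fst d"
    and d': "d' \<in> A" "p \<in> fst d'"
  shows "frechet_derivative (transition c d') (at (snd c p)) x =
    frechet_derivative (transition d d') (at (snd d p))
      (frechet_derivative (transition c d) (at (snd c p)) x)"
proof -
  have ch: "chart_on X c" "chart_on X d"
    using A c d by (auto simp: smooth_atlas_def)
  have "transition c d (snd c p) = snd d p"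
    using chart_inv_chart[OF ch(1) c(2)] by (simp add: transition_def)
  then have "(transition d d' \<circ> transition c d has_derivative
      frechet_derivative (transition d d') (at (snd d p)) \<circ>
      frechet_derivative (transition c d) (at (snd c p))) (at (snd c p))"
    using transition_has_derivative[OF A c(1) d(1) c(2) d(2)]
      transition_has_derivative[OF A d(1) d'(1) d(2) d'(2)]
    by (intro diff_chain_at) simp_all
  \<comment> \<open>The composite is known to agree with the direct transition map on the image of
    the overlap; this open set around the point suffices for the derivative.\<close>
  then have "(transition c d' has_derivative
      frechet_derivative (transition d d') (at (snd d p)) \<circ>
      frechet_derivative (transition c d) (at (snd c p))) (at (snd c p))"
  proof (rule has_derivative_transform_within_open)
    show "open (snd c ` (fst c \<inter> fst d))"
      using ch by (rule open_chart_overlap)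
    show "snd c p \<in> snd c ` (fst c \<inter> fst d)"
      using c d by blast
    show "(transition d d' \<circ> transition c d) y = transition c d' y"
      if "y \<in> snd c ` (fst c \<inter> fst d)" for y
      using that chart_inv_chart[OF ch(1)] chart_inv_chart[OF ch(2)]
      by (auto simp: transition_def)
  qed
  then show ?thesis
    using frechet_derivative_at by (metis comp_apply)
qed

lemma transition_self_derivative:
  assumes A: "smooth_atlas X A" and c: "c \<in> A" "p \<in> fst c"
  shows "frechet_derivative (transition c c) (at (snd c p)) x = x"
proof -
  have ch: "chart_on X c"
    using A c by (auto simp: smooth_atlas_def)
  have "(transition c c has_derivative (\<lambda>x. x)) (at (snd c p))"
  proof (rule has_derivative_transform_within_open)
    show "((\<lambda>x. x) has_derivative (\<lambda>x. x)) (at (snd c p))"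
      by (rule has_derivative_ident)
    show "open (snd c ` (fst c \<inter> fst c))"
      using ch ch by (rule open_chart_overlap)
    show "snd c p \<in> snd c ` (fst c \<inter> fst c)"
      using c by blast
    show "y = transition c c y" if "y \<in> snd c ` (fst c \<inter> fst c)" for y
      using that chart_inv_chart[OF ch] by (auto simp: transition_def)
  qed
  then show ?thesis
    using frechet_derivative_at by metis
qed

text \<open>The candidate inverse of the coordinate map \<open>v \<mapsto> v c\<close>. It lets
  linear algebra on \<open>real^'n\<close> be carried over to the tangent space.\<close>

definition tangent_lift ::
    "('a, 'n::finite) riemannian_structure \<Rightarrow> ('a, 'n) chart \<Rightarrow> 'a \<Rightarrow> real^'n \<Rightarrow> ('a, 'n) tangent_vector"
  where "tangent_lift M c p x =
    (\<lambda>d. if d \<in> charts_at M p then frechet_derivative (transition c d) (at (snd c p)) x else 0)"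

lemma coord_vector_eq_tangent_lift: "coord_vector M c p i = tangent_lift M c p (axis i 1)"
  by (simp add: coord_vector_def tangent_lift_def)

section \<open>The tangent space and its metric in the coordinates of one chart\<close>

context
  fixes M :: "('a, 'n::finite) riemannian_structure" and c :: "('a, 'n) chart" and p :: 'a
  assumes riem: "riemannian_manifold M" and c: "c \<in> charts_at M p"
begin

lemma smooth_atlas_riemannian: "smooth_atlas (mtopology M) (atlas M)"
  using riem by (simp add: riemannian_manifold_def)

lemma chart_at_atlas: "c \<in> atlas M" "p \<in> fst c"
  using c by (auto simp: charts_at_def)

lemma chart_at_points: "p \<in> points M"
  using smooth_atlas_riemannian chart_at_atlas unfolding smooth_atlas_def by blast

lemma metric_inner_product: "inner_product_on (tangent_space M p) (metric M p)"
  using riem chart_at_points by (simp add: riemannian_manifold_def)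

lemma linear_tangent_lift: "linear (tangent_lift M c p)"
proof (intro linearI)
  have lin: "linear (frechet_derivative (transition c d) (at (snd c p)))" if "d \<in> charts_at M p" for d
    using that transition_has_derivative[OF smooth_atlas_riemannian, of c d p] chart_at_atlas
    by (simp add: charts_at_def has_derivative_linear)
  show "tangent_lift M c p (x + y) = tangent_lift M c p x + tangent_lift M c p y" for x y
    by (auto simp: fun_eq_iff tangent_lift_def linear_add[OF lin])
  show "tangent_lift M c p (r *\<^sub>R x) = r *\<^sub>R tangent_lift M c p x" for r x
    by (auto simp: fun_eq_iff tangent_lift_def scaleR_fun_def linear_cmul[OF lin])
qed

lemma tangent_lift_chart: "tangent_lift M c p x c = x"
  using c transition_self_derivative[OF smooth_atlas_riemannian chart_at_atlas]
  by (simp add: tangent_lift_def)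

text \<open>The compatibility condition on tangent vectors is exactly the chain rule for transition
  maps.\<close>

lemma tangent_lift_in_tangent_space: "tangent_lift M c p x \<in> tangent_space M p"
proof -
  have "tangent_lift M c p x d' =
      frechet_derivative (transition d d') (at (snd d p)) (tangent_lift M c p x d)"
    if "d \<in> charts_at M p" "d' \<in> charts_at M p" for d d'
    using that transition_derivative_compose[OF smooth_atlas_riemannian chart_at_atlas, of d d' x]
    by (simp add: tangent_lift_def charts_at_def)
  moreover have "tangent_lift M c p x d = 0" if "d \<notin> charts_at M p" for d
    using that by (simp add: tangent_lift_def)
  ultimately show ?thesis
    unfolding tangent_space_def by blast
qed

lemma tangent_lift_coordinates:
  assumes "v \<in> tangent_space M p"
  shows "tangent_lift M c p (v c) = v"
proof
  fix d
  have "d \<in> charts_at M p \<Longrightarrow> v d = frechet_derivative (transition c d) (at (snd c p)) (v c)"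
    "d \<notin> charts_at M p \<Longrightarrow> v d = 0"
    using assms c unfolding tangent_space_def by blast+
  then show "tangent_lift M c p (v c) d = v d"
    unfolding tangent_lift_def by presburger
qed

lemma subspace_tangent_space: "subspace (tangent_space M p)"
proof -
  have "tangent_space M p = range (tangent_lift M c p)"
  proof (intro equalityI subsetI)
    fix v assume "v \<in> tangent_space M p"
    then have "tangent_lift M c p (v c) = v"
      by (rule tangent_lift_coordinates)
    then show "v \<in> range (tangent_lift M c p)"
      by (metis rangeI)
  qed (auto simp: tangent_lift_in_tangent_space)
  then show ?thesis
    using linear_subspace_image[OF linear_tangent_lift subspace_UNIV] by simp
qed

text \<open>Pulling the metric back along the linear lift preserves all the laws; positivity also
  needs the lift to be injective.\<close>

lemma inner_product_on_coordinates:
  "inner_product_on UNIV (\<lambda>x y. metric M p (tangent_lift M c p x) (tangent_lift M c p y))"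
proof -
  note ip = metric_inner_product[unfolded inner_product_on_def]
  have "tangent_lift M c p x \<noteq> 0" if "x \<noteq> 0" for x
    using that tangent_lift_chart[of x] by (metis zero_fun_apply)
  then show ?thesis
    unfolding inner_product_on_def
      linear_add[OF linear_tangent_lift] linear_cmul[OF linear_tangent_lift]
    by (intro conjI ballI allI impI
        ip[THEN conjunct1, rule_format]
        ip[THEN conjunct2, THEN conjunct1, rule_format]
        ip[THEN conjunct2, THEN conjunct2, THEN conjunct1, rule_format]
        ip[THEN conjunct2, THEN conjunct2, THEN conjunct2, rule_format]
        tangent_lift_in_tangent_space)
qed

text \<open>Expand both arguments in the standard basis, whose lifts are the coordinate vectors that
  define the metric matrix.\<close>

lemma metric_coordinates:
  "metric M p (tangent_lift M c p x) (tangent_lift M c p y) = x \<bullet> (metric_matrix M c (snd c p) *v y)"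
proof -
  define b where "b x y = metric M p (tangent_lift M c p x) (tangent_lift M c p y)" for x y
  have "bilinear b"
    unfolding b_def using inner_product_on_coordinates by (rule inner_product_on_UNIV_imp_bilinear)
  then have lin: "linear (b u)" "linear (\<lambda>u. b u v)" for u v
    by (simp_all add: bilinear_def)
  have "chart_inv c (snd c p) = p"
    using smooth_atlas_riemannian chart_at_atlas
    by (intro chart_inv_chart[of "mtopology M"]) (auto simp: smooth_atlas_def)
  then have G: "metric_matrix M c (snd c p) $ i $ j = b (axis i 1) (axis j 1)" for i j
    by (simp add: metric_matrix_def b_def coord_vector_eq_tangent_lift)
  have exp: "z = (\<Sum>i\<in>UNIV. z $ i *\<^sub>R axis i 1)" for z :: "real^'n"
    using basis_expansion[of z] by (simp add: scalar_mult_eq_scaleR)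
  have "b x y = b (\<Sum>i\<in>UNIV. x $ i *\<^sub>R axis i 1) (\<Sum>j\<in>UNIV. y $ j *\<^sub>R axis j 1)"
    by (simp only: exp[symmetric])
  also have "\<dots> = (\<Sum>i\<in>UNIV. x $ i * b (axis i 1) (\<Sum>j\<in>UNIV. y $ j *\<^sub>R axis j 1))"
    by (simp only: linear_sum[OF lin(2)] linear_cmul[OF lin(2)] real_scaleR_def)
  also have "\<dots> = (\<Sum>i\<in>UNIV. \<Sum>j\<in>UNIV. x $ i * (y $ j * b (axis i 1) (axis j 1)))"
    by (simp only: linear_sum[OF lin(1)] linear_cmul[OF lin(1)] sum_distrib_left real_scaleR_def)
  finally show ?thesis
    by (simp add: b_def[symmetric] inner_vec_def matrix_vector_mult_def G sum_distrib_left
        mult_ac)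
qed

text \<open>Existence is the orthonormal expansion; uniqueness holds because pairing with
  \<open>e (\<sigma> j)\<close> recovers the \<open>j\<close>-th coefficient. The bijection
  \<open>\<sigma>\<close> allows the lines to be numbered by a set other than
  \<open>'n\<close>.\<close>

lemma orthonormal_direct_sum:
  fixes e :: "'n \<Rightarrow> real^'n" and \<sigma> :: "'i \<Rightarrow> 'n"
  assumes I: "finite I" and \<sigma>: "bij_betw \<sigma> I UNIV"
    and e: "orthonormal_family (\<lambda>x y. x \<bullet> (metric_matrix M c (snd c p) *v y)) UNIV e"
  shows "direct_sum_decomposition (tangent_space M p) I (\<lambda>i. span {tangent_lift M c p (e (\<sigma> i))})"
proof -
  let ?L = "tangent_lift M c p"
  let ?b = "\<lambda>x y. x \<bullet> (metric_matrix M c (snd c p) *v y)"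
  \<comment> \<open>The restriction gives the value \<open>undefined\<close> outside
    \<open>I\<close>, as membership in \<open>\<Pi>\<^sub>E\<close> demands.\<close>
  define w0 where "w0 v = restrict (\<lambda>i. ?b (e (\<sigma> i)) (v c) *\<^sub>R ?L (e (\<sigma> i))) I" for v
  have inj: "\<sigma> i = \<sigma> j \<longleftrightarrow> i = j" if "i \<in> I" "j \<in> I" for i j
    using \<sigma> that by (auto simp: bij_betw_def inj_on_def)
  have uniq: "w = w0 v" if w: "w \<in> (\<Pi>\<^sub>E i\<in>I. span {?L (e (\<sigma> i))})" and v: "v = (\<Sum>i\<in>I. w i)" for w v
  proof -
    have "\<forall>i\<in>I. \<exists>r. w i = r *\<^sub>R ?L (e (\<sigma> i))"
      using w by (force simp: PiE_iff span_singleton)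
    then obtain r where r: "\<And>i. i \<in> I \<Longrightarrow> w i = r i *\<^sub>R ?L (e (\<sigma> i))"
      by metis
    have "v = ?L (\<Sum>i\<in>I. r i *\<^sub>R e (\<sigma> i))"
      unfolding v by (simp add: linear_sum[OF linear_tangent_lift] linear_cmul[OF linear_tangent_lift] r)
    then have vc: "v c = (\<Sum>i\<in>I. r i *\<^sub>R e (\<sigma> i))"
      by (simp add: tangent_lift_chart)
    have "?b (e (\<sigma> j)) (v c) = r j" if j: "j \<in> I" for j
    proof -
      have "?b (e (\<sigma> j)) (v c) = (\<Sum>i\<in>I. r i * ?b (e (\<sigma> j)) (e (\<sigma> i)))"
        by (simp add: vc linear_sum[OF matrix_vector_mul_linear]
            linear_cmul[OF matrix_vector_mul_linear] inner_sum_right)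
      also have "\<dots> = (\<Sum>i\<in>I. if i = j then r j else 0)"
        using e inj j by (intro sum.cong) (auto simp: orthonormal_family_def)
      also have "\<dots> = r j"
        using I j by simp
      finally show ?thesis .
    qed
    then show ?thesis
      using r w by (auto simp: w0_def fun_eq_iff PiE_iff extensional_def)
  qed
  have mem: "w0 v \<in> (\<Pi>\<^sub>E i\<in>I. span {?L (e (\<sigma> i))})" for v
    by (auto simp: w0_def intro: span_scale span_base)
  have "v = (\<Sum>i\<in>I. w0 v i)" if "v \<in> tangent_space M p" for v
  proof -
    have "v c = (\<Sum>a\<in>UNIV. ?b (e a) (v c) *\<^sub>R e a)"
      using e by (rule orthonormal_family_expansion)
    also have "\<dots> = (\<Sum>i\<in>I. ?b (e (\<sigma> i)) (v c) *\<^sub>R e (\<sigma> i))"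
      using sum.reindex_bij_betw[OF \<sigma>, of "\<lambda>a. ?b (e a) (v c) *\<^sub>R e a"] by simp
    finally have "?L (v c) = ?L (\<Sum>i\<in>I. ?b (e (\<sigma> i)) (v c) *\<^sub>R e (\<sigma> i))"
      by (rule arg_cong)
    also have "\<dots> = (\<Sum>i\<in>I. w0 v i)"
      by (simp add: w0_def linear_sum[OF linear_tangent_lift] linear_cmul[OF linear_tangent_lift])
    finally have "?L (v c) = (\<Sum>i\<in>I. w0 v i)" .
    then show ?thesis
      using tangent_lift_coordinates[OF that] by simp
  qed
  then have "\<exists>!w. w \<in> (\<Pi>\<^sub>E i\<in>I. span {?L (e (\<sigma> i))}) \<and> v = (\<Sum>i\<in>I. w i)"
    if "v \<in> tangent_space M p" for v
    using that mem uniq by (intro ex1I[of _ "w0 v"] conjI) simp_all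
  moreover have "span {?L (e (\<sigma> i))} \<subseteq> tangent_space M p" for i
    by (intro span_minimal subspace_tangent_space) (simp add: tangent_lift_in_tangent_space)
  ultimately show ?thesis
    by (simp add: direct_sum_decomposition_def)
qed

end

section \<open>The decomposition of the tangent space into lines\<close>

theorem lemma3:
  fixes M :: "('a, 'n::finite) riemannian_structure" and lam :: real and p :: 'a
  assumes "riemannian_manifold M"
    and "CARD('n) = 3 \<or> (\<exists>H :: real^'n^'n. hadamard_matrix H)"
    and "\<forall>q\<in>points M. scalar_curvature M q = real CARD('n) * lam"
    and "p \<in> points M"
  shows "\<exists>D :: nat \<Rightarrow> ('a, 'n) tangent_vector set.
    direct_sum_decomposition (tangent_space M p) {1..CARD('n)} D \<and>
    (\<forall>\<mu>\<in>{1..CARD('n)}. dim (D \<mu>) = 1) \<and>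
    (\<forall>\<mu>\<in>{1..CARD('n)}. \<forall>\<nu>\<in>{1..CARD('n)}. \<mu> \<noteq> \<nu> \<longrightarrow>
        (\<forall>u\<in>D \<mu>. \<forall>v\<in>D \<nu>. metric M p u v = 0)) \<and>
    (\<forall>\<mu>\<in>{1..CARD('n)}. \<forall>u\<in>D \<mu>. \<forall>v\<in>D \<mu>. ricci M p u v = lam * metric M p u v)"
proof -
  \<comment> \<open>This is the chart in which \<open>ricci\<close> and
    \<open>scalar_curvature\<close> are evaluated at \<open>p\<close>, so both can be unfolded
    without a change of chart.\<close>
  define c where "c = chart_at M p"
  have "p \<in> \<Union> (fst ` atlas M)"
    using assms(1,4) unfolding riemannian_manifold_def smooth_atlas_def by blast
  then have "charts_at M p \<noteq> {}"
    by (auto simp: charts_at_def)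
  then have c: "c \<in> charts_at M p"
    by (simp add: c_def chart_at_def some_in_eq)
  note ctx = assms(1) c
  let ?L = "tangent_lift M c p"
  define G where "G = metric_matrix M c (snd c p)"
  define R where "R = ricci_matrix M c (snd c p)"
  define b where "b = (\<lambda>x y. x \<bullet> (G *v y))"
  define B where "B = (\<lambda>x y. x \<bullet> (R *v y))"
  have metric: "metric M p (?L x) (?L y) = b x y" for x y
    using metric_coordinates[OF ctx] by (simp add: G_def b_def)
  have ricci: "ricci M p (?L x) (?L y) = B x y" for x y
    using tangent_lift_chart[OF ctx]
    by (simp add: ricci_def Let_def B_def R_def inner_vec_def matrix_vector_mult_def
        sum_distrib_left mult_ac flip: c_def)
  have ip: "inner_product_on UNIV b"
    using inner_product_on_coordinates[OF ctx] by (simp add: metric)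
  note bil_b = inner_product_on_UNIV_imp_bilinear[OF ip]
  have sym: "b x y = b y x" for x y
    using ip unfolding inner_product_on_def by blast
  have bil_B: "bilinear B"
    by (auto simp: bilinear_def B_def inner_left_distrib inner_right_distrib
        matrix_vector_right_distrib matrix_vector_mult_scaleR intro!: linearI)
  obtain e0 :: "'n \<Rightarrow> real^'n" where e0: "orthonormal_family b UNIV e0"
    using ex_orthonormal_family[OF ip, of "UNIV :: 'n set"] by auto
  \<comment> \<open>The scalar curvature is the trace of the Ricci form in a
    \<open>g\<close>-orthonormal basis, which supplies the mean value \<open>lam\<close> of the
    diagonal.\<close>
  have "(\<Sum>a\<in>UNIV. B (e0 a) (e0 a)) = scalar_curvature M p"
    using orthonormal_family_matrix_inv[OF e0[unfolded b_def], of R]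
    by (simp add: B_def scalar_curvature_def Let_def G_def R_def flip: c_def)
  then have tr: "(\<Sum>a\<in>UNIV. B (e0 a) (e0 a)) = real CARD('n) * lam"
    using assms(3,4) by simp
  obtain e :: "'n \<Rightarrow> real^'n" where e: "orthonormal_family b UNIV e" and diag: "\<And>a. B (e a) (e a) = lam"
    using orthonormal_family_constant_diagonal[OF bil_b sym bil_B finite e0 tr] by auto
  obtain \<sigma> :: "nat \<Rightarrow> 'n" where \<sigma>: "bij_betw \<sigma> {1..CARD('n)} UNIV"
    using ex_bij_betw_nat_finite_1[of "UNIV :: 'n set"] by auto
  define D where "D \<mu> = span {?L (e (\<sigma> \<mu>))}" for \<mu>
  \<comment> \<open>Moving the scalar inside the lift brings elements of the lines into the form to
    which \<open>metric\<close> and \<open>ricci\<close> apply.\<close>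
  have D: "u \<in> D \<mu> \<longleftrightarrow> (\<exists>r. u = ?L (r *\<^sub>R e (\<sigma> \<mu>)))" for u \<mu>
    by (auto simp: D_def span_singleton linear_cmul[OF linear_tangent_lift[OF ctx]])
  have orth: "b (e i) (e j) = (if i = j then 1 else 0)" for i j
    using e by (simp add: orthonormal_family_def)
  have "direct_sum_decomposition (tangent_space M p) {1..CARD('n)} D"
    unfolding D_def[abs_def] using e \<sigma>
    by (intro orthonormal_direct_sum[OF ctx]) (simp_all add: b_def G_def)
  moreover have "dim (D \<mu>) = 1" for \<mu>
  proof -
    have "b (e (\<sigma> \<mu>)) (e (\<sigma> \<mu>)) = 1"
      by (simp add: orth)
    then have "e (\<sigma> \<mu>) \<noteq> 0"
      by (auto simp: bilinear_lzero[OF bil_b])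
    then have "?L (e (\<sigma> \<mu>)) \<noteq> 0"
      using tangent_lift_chart[OF ctx, of "e (\<sigma> \<mu>)"] by auto
    then show ?thesis
      by (simp add: D_def dim_eq_card_independent)
  qed
  moreover have "metric M p u v = 0"
    if idx: "\<mu> \<in> {1..CARD('n)}" "\<nu> \<in> {1..CARD('n)}" "\<mu> \<noteq> \<nu>" and uv: "u \<in> D \<mu>" "v \<in> D \<nu>" for \<mu> \<nu> u v
  proof -
    have "\<sigma> \<mu> \<noteq> \<sigma> \<nu>"
      using inj_on_eq_iff[OF bij_betw_imp_inj_on[OF \<sigma>] idx(1,2)] idx(3) by simp
    moreover obtain r s where "u = ?L (r *\<^sub>R e (\<sigma> \<mu>))" "v = ?L (s *\<^sub>R e (\<sigma> \<nu>))"
      using uv D by blast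
    ultimately show ?thesis
      by (simp add: metric bilinear_lmul[OF bil_b] bilinear_rmul[OF bil_b] orth)
  qed
  moreover have "ricci M p u v = lam * metric M p u v" if uv: "u \<in> D \<mu>" "v \<in> D \<mu>" for \<mu> u v
  proof -
    obtain r s where "u = ?L (r *\<^sub>R e (\<sigma> \<mu>))" "v = ?L (s *\<^sub>R e (\<sigma> \<mu>))"
      using uv D by blast
    \<comment> \<open>On a line both forms are \<open>r * s\<close> times their value on the
      generator, namely \<open>lam\<close> for Ricci and \<open>1\<close> for the metric.\<close>
    then show ?thesis
      by (simp add: metric ricci bilinear_lmul[OF bil_b] bilinear_rmul[OF bil_b]
          bilinear_lmul[OF bil_B] bilinear_rmul[OF bil_B] orth diag)
  qed
  ultimately show ?thesis
    by (intro exI[of _ D]) blast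
qed

end
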